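(* Let $u$ and $v$ be positive real numbers, and let $\mu(\pi)$ be the irrationality measure of $\pi$. (1) If the sequence $\left(\frac{1}{n^u\cdot |\sin(n)|^v}\right)_{n\ge 1}$ converges, then $\mu(\pi)\leq 1+\frac{u}{v}$. (2) If the sequence $\left(\frac{1}{n^u\cdot |\sin(n)|^v}\right)_{n\ge 1}$ diverges, then $\mu(\pi) \geq 1+\frac{u}{v}$.
   Context: The irrationality measure $\mu(x)$ of a positive real number $x$ is the infimum of those $m$ for which the inequality $0 < \left|x - \frac{p}{q}\right| < \frac{1}{q^m}$ holds only for a finite number of pairs of co-prime positive integers $p$ and $q$. If no such $m$ exists, then $\mu(x) = +\infty$. A sequence converges if it has a finite limit, and diverges otherwise. *)

theory Defs
  imports Complex_Main "HOL-Library.Extended_Real"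
begin

definition good_approximations :: "real \<Rightarrow> real \<Rightarrow> (nat \<times> nat) set" where
  "good_approximations x m =
     {(p, q). p > 0 \<and> q > 0 \<and> coprime p q \<and>
        0 < \<bar>x - real p / real q\<bar> \<and> \<bar>x - real p / real q\<bar> < 1 / real q powr m}"

(* The exponent m ranges over all reals. The infimum is taken in the extended reals,
   so that it is \<infinity> when no such m exists. Intended for x > 0 only, since numerators
   are positive. *)
definition irrationality_measure :: "real \<Rightarrow> ereal" where
  "irrationality_measure x = Inf (ereal ` {m. finite (good_approximations x m)})"

end

theory Submission
  imports Defs
begin

text \<open>
  If \<open>p/q\<close> is close to \<open>\<pi>\<close> then \<open>\<bar>sin p\<bar> = \<bar>sin (p - q\<pi>)\<bar>\<close> is comparable to \<open>q\<bar>\<pi> - p/q\<bar>\<close>.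
  Hence a bounded sequence keeps every approximation of order \<open>m > 1 + u/v\<close> in a finite range, while
  finitely many approximations of order \<open>m < 1 + u/v\<close> force \<open>\<bar>sin n\<bar> \<ge> c n\<^sup>1\<^sup>-\<^sup>m\<close> unless \<open>sin n = 0\<close>, so that the sequence
  tends to 0. The irrationality of \<open>\<pi>\<close> plays no role: where \<open>sin n = 0\<close>, the convention
  \<open>1/0 = 0\<close> makes the term vanish.
\<close>

text \<open>The cubic Taylor remainder is at most \<open>\<bar>x\<bar> ^ 3 / 6\<close>, hence at
  most two thirds of \<open>\<bar>x\<bar>\<close> on this range. The radius 2 covers the distance
  from an integer to the multiple of \<open>pi\<close> chosen by rounding, estimated as half of
  4.\<close>

lemma abs_sin_ge_third:
  fixes x :: real
  assumes "\<bar>x\<bar> \<le> 2"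
  shows "\<bar>x\<bar> / 3 \<le> \<bar>sin x\<bar>"
proof -
  have "\<bar>sin x - x\<bar> \<le> \<bar>x\<bar> ^ 3 / 6"
    using Maclaurin_sin_bound[of x 3] by (simp add: numeral_3_eq_3 sin_coeff_def field_simps)
  moreover have "\<bar>x\<bar> ^ 3 \<le> 4 * \<bar>x\<bar>"
    using mult_right_mono[OF power_mono[OF assms, of 2], of "\<bar>x\<bar>"]
    by (simp add: power3_eq_cube power2_eq_square)
  ultimately show ?thesis by linarith
qed

lemma good_approximations_antimono:
  assumes "m \<le> m'"
  shows "good_approximations x m' \<subseteq> good_approximations x m"
proof (clarsimp simp: good_approximations_def)
  fix p q :: nat
  assume q: "0 < q" and less: "\<bar>x - real p / real q\<bar> < 1 / real q powr m'"
  have "real q powr m \<le> real q powr m'"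
    using assms q by (intro powr_mono) auto
  then have "1 / real q powr m' \<le> 1 / real q powr m"
    using q by (intro divide_left_mono) auto
  with less show "\<bar>x - real p / real q\<bar> < 1 / real q powr m" by linarith
qed

text \<open>Reduce \<open>p / q\<close> to lowest terms. The reduced fraction is either one of
  finitely many exceptions, whose distances from \<open>x\<close> have a positive minimum, or it
  violates the defining inequality. As \<open>m\<close> is nonnegative, the bound for the smaller
  reduced denominator implies the one for \<open>q\<close>.\<close>

lemma finite_good_approximations_lower_bound:
  assumes fin: "finite (good_approximations x m)" and m: "0 \<le> m"
  obtains c where "0 < c"
    and "\<And>p q. 0 < p \<Longrightarrow> 0 < q \<Longrightarrow> x \<noteq> real p / real q \<Longrightarrow> c / real q powr m \<le> \<bar>x - real p / real q\<bar>"
proof -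
  \<comment> \<open>The inserted 1 keeps the set nonempty and gives \<open>c \<le> 1\<close>, which
    the non-exceptional fractions require.\<close>
  define c where "c = Min (insert 1 ((\<lambda>(p, q). \<bar>x - real p / real q\<bar>) ` good_approximations x m))"
  have c_le: "c \<le> 1" "\<And>p q. (p, q) \<in> good_approximations x m \<Longrightarrow> c \<le> \<bar>x - real p / real q\<bar>"
    unfolding c_def using fin by (auto intro!: Min_le)
  have c_pos: "0 < c"
    unfolding c_def using fin by (subst Min_gr_iff) (auto simp: good_approximations_def)
  have "c / real q powr m \<le> \<bar>x - real p / real q\<bar>"
    if p: "0 < p" and q: "0 < q" and ne: "x \<noteq> real p / real q" for p q :: nat
  proof -
    define d where "d = gcd p q"
    define p' q' where "p' = p div d" and "q' = q div d"
    have d: "0 < d" using p by (simp add: d_def)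
    have pq: "p = p' * d" "q = q' * d" by (simp_all add: p'_def q'_def d_def)
    have pos: "0 < p'" "0 < q'" using p q pq by (auto intro!: Nat.gr0I)
    have cop: "coprime p' q'" unfolding p'_def q'_def d_def using p by (intro div_gcd_coprime) auto
    have frac: "real p / real q = real p' / real q'" using d by (simp add: pq)
    have "q' \<le> q" by (simp add: q'_def)
    then have powr: "real q' powr m \<le> real q powr m" using m by (intro powr_mono2) auto
    have q1: "1 \<le> real q powr m" using q m by (intro ge_one_powr_ge_zero) auto
    show ?thesis
    proof (cases "(p', q') \<in> good_approximations x m")
      case True
      have "c / real q powr m \<le> c"
        using q1 c_pos by (simp add: divide_le_eq)
      with c_le(2)[OF True] frac show ?thesis by simp
    next
      case False
      then have "1 / real q' powr m \<le> \<bar>x - real p / real q\<bar>"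
        using pos cop ne frac by (auto simp: good_approximations_def not_less)
      moreover have "c / real q powr m \<le> 1 / real q' powr m"
        using c_le(1) c_pos powr pos by (intro frac_le) auto
      ultimately show ?thesis by linarith
    qed
  qed
  with c_pos that show thesis by blast
qed

lemma abs_diff_mult_eq:
  fixes a b x :: real
  assumes "0 < b"
  shows "\<bar>a - b * x\<bar> = b * \<bar>x - a / b\<bar>"
proof -
  have "a - b * x = b * (a / b - x)" using assms by (simp add: right_diff_distrib)
  then show ?thesis using assms by (simp add: abs_mult abs_minus_commute)
qed

lemma sin_minus_nat_pi: "\<bar>sin (x - real q * pi)\<bar> = \<bar>sin x\<bar>"
  by (simp add: sin_diff abs_mult cos_npi power_abs)

text \<open>For a good approximation, \<open>\<bar>sin p\<bar>\<close> is at most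
  \<open>q powr (1 - m)\<close> and \<open>p\<close> is at most \<open>5 * q\<close>. The bound at
  \<open>n = p\<close> then yields \<open>q powr e \<le> C * 5 powr u\<close> with
  \<open>e > 0\<close>; solving for \<open>q\<close> gives the threshold \<open>K\<close>.\<close>

lemma finite_good_approximations_pi:
  fixes u v C :: real
  assumes "u > 0" "v > 0"
    and bound: "\<And>n. 0 < n \<Longrightarrow> 1 / (real n powr u * \<bar>sin (real n)\<bar> powr v) \<le> C"
    and m: "1 + u / v < m"
  shows "finite (good_approximations pi m)"
proof -
  define e where "e = (m - 1) * v - u"
  have e: "0 < e" using m \<open>v > 0\<close> by (simp add: e_def field_simps)
  have m1: "1 < m" using m assms divide_pos_pos[of u v] by linarith
  define K where "K = (C * 5 powr u) powr (1 / e)"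
  have "q \<le> nat \<lfloor>K\<rfloor> \<and> p \<le> 5 * nat \<lfloor>K\<rfloor>" if "(p, q) \<in> good_approximations pi m" for p q
  proof -
    have p: "0 < p" and q: "0 < q" and ne: "0 < \<bar>pi - real p / real q\<bar>"
      and less: "\<bar>pi - real p / real q\<bar> < 1 / real q powr m"
      using that by (auto simp: good_approximations_def)
    define y where "y = real p - real q * pi"
    have y_eq: "\<bar>y\<bar> = real q * \<bar>pi - real p / real q\<bar>"
      using abs_diff_mult_eq[of "real q" "real p" pi] q by (simp add: y_def)
    have "\<bar>y\<bar> < real q * (1 / real q powr m)"
      unfolding y_eq using less q by (intro mult_strict_left_mono) auto
    also have "\<dots> = real q powr (1 - m)" using q by (simp add: powr_diff)
    finally have y_less: "\<bar>y\<bar> < real q powr (1 - m)" .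
    also have "\<dots> \<le> real q powr 0" using q m1 by (intro powr_mono) auto
    finally have y1: "\<bar>y\<bar> < 1" using q by simp
    have y0: "y \<noteq> 0" using y_eq ne q by auto
    have sin_eq: "\<bar>sin (real p)\<bar> = \<bar>sin y\<bar>" unfolding y_def by (rule sin_minus_nat_pi [symmetric])
    \<comment> \<open>Without this the term at \<open>p\<close> would be 1/0 = 0 and
      \<open>bound\<close> would say nothing about \<open>q\<close>.\<close>
    have sin0: "0 < \<bar>sin (real p)\<bar>"
      using sin_zero_pi_iff[of y] y0 y1 pi_ge_two sin_eq by simp
    have sin_le: "\<bar>sin (real p)\<bar> \<le> real q powr (1 - m)"
      using abs_sin_x_le_abs_x[of y] y_less sin_eq by linarith
    \<comment> \<open>The factor 5 arises from \<open>p < 4 * q + 1\<close> and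
      \<open>1 \<le> q\<close>.\<close>
    have "real q * pi \<le> real q * 4" using pi_less_4 by (intro mult_left_mono) auto
    then have p_le: "real p \<le> 5 * real q" using y1 q unfolding y_def by linarith
    have "1 \<le> C * (real p powr u * \<bar>sin (real p)\<bar> powr v)"
      using bound[OF p] p sin0 by (simp add: divide_le_eq)
    moreover have "real p powr u * \<bar>sin (real p)\<bar> powr v \<le> (5 * real q) powr u * (real q powr (1 - m)) powr v"
      using p_le sin_le sin0 assms by (intro mult_mono powr_mono2) auto
    moreover have "(5 * real q) powr u * (real q powr (1 - m)) powr v = 5 powr u * real q powr - e"
      using q by (simp add: powr_mult powr_powr powr_add[symmetric] e_def algebra_simps)
    moreover have "0 \<le> C" using bound[of 1] by (rule order_trans[rotated]) auto
    ultimately have "1 \<le> C * (5 powr u * real q powr - e)"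
      by (metis mult_left_mono order_trans)
    then have "real q powr e \<le> C * 5 powr u"
      using q by (simp add: powr_minus field_simps)
    then have "(real q powr e) powr (1 / e) \<le> K"
      unfolding K_def using e by (intro powr_mono2) auto
    then have "real q \<le> K" using q e by (simp add: powr_powr)
    then have "q \<le> nat \<lfloor>K\<rfloor>" by linarith
    moreover have "p \<le> 5 * q" using p_le by linarith
    ultimately show ?thesis by linarith
  qed
  then have "good_approximations pi m \<subseteq> {..5 * nat \<lfloor>K\<rfloor>} \<times> {..nat \<lfloor>K\<rfloor>}" by auto
  then show ?thesis by (rule finite_subset) auto
qed

text \<open>Take \<open>q\<close> to be the integer nearest to \<open>n / pi\<close>. Then
  \<open>n - q * pi\<close> is small enough for its sine to be comparable to it, and its size is
  \<open>q\<close> times the distance from \<open>pi\<close> to \<open>n / q\<close>, which is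
  bounded below.\<close>

lemma abs_sin_nat_lower_bound:
  assumes fin: "finite (good_approximations pi m)" and m: "1 \<le> m"
  obtains c where "0 < c"
    and "\<And>n. 2 \<le> n \<Longrightarrow> sin (real n) \<noteq> 0 \<Longrightarrow> c * real n powr (1 - m) \<le> \<bar>sin (real n)\<bar>"
proof -
  from fin m obtain c where c: "0 < c"
    and lower: "\<And>p q. 0 < p \<Longrightarrow> 0 < q \<Longrightarrow> pi \<noteq> real p / real q \<Longrightarrow> c / real q powr m \<le> \<bar>pi - real p / real q\<bar>"
    by (auto elim: finite_good_approximations_lower_bound)
  have "c / 3 * real n powr (1 - m) \<le> \<bar>sin (real n)\<bar>" if n: "2 \<le> n" and sin0: "sin (real n) \<noteq> 0" for n
  proof -
    define q where "q = nat (round (real n / pi))"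
    \<comment> \<open>This is where \<open>2 \<le> n\<close> matters: for \<open>n = 1\<close> the
      quotient would round to 0.\<close>
    have "2 / 4 < real n / pi" using n pi_less_4 by (intro frac_less2) auto
    then have half: "1 / 2 < real n / pi" by simp
    have round: "\<bar>of_int (round (real n / pi)) - real n / pi\<bar> \<le> 1 / 2" by (rule of_int_round_abs_le)
    with half have "0 < round (real n / pi)" by linarith
    then have q: "0 < q" and q_round: "real q = of_int (round (real n / pi))" by (auto simp: q_def)
    have "real n / pi \<le> real n / 2" using pi_ge_two by (intro frac_le) auto
    then have q_le: "real q \<le> real n" using round n unfolding q_round by linarith
    define y where "y = real n - real q * pi"
    have "\<bar>y\<bar> = pi * \<bar>real q - real n / pi\<bar>"
      using abs_diff_mult_eq[of pi "real n" "real q"] by (simp add: y_def mult.commute)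
    also have "\<dots> \<le> 4 * (1 / 2)" using round pi_less_4 unfolding q_round by (intro mult_mono) auto
    finally have y2: "\<bar>y\<bar> \<le> 2" by simp
    have sin_eq: "\<bar>sin (real n)\<bar> = \<bar>sin y\<bar>" unfolding y_def by (rule sin_minus_nat_pi [symmetric])
    then have "y \<noteq> 0" using sin0 by auto
    then have ne: "pi \<noteq> real n / real q" using q by (simp add: y_def eq_divide_eq mult.commute)
    have y_eq: "\<bar>y\<bar> = real q * \<bar>pi - real n / real q\<bar>"
      using abs_diff_mult_eq[of "real q" "real n" pi] q by (simp add: y_def)
    \<comment> \<open>The exponent is nonpositive, so replacing \<open>n\<close> by the smaller
      \<open>q\<close> can only increase the power.\<close>
    have "c * real n powr (1 - m) \<le> c * real q powr (1 - m)"
      using c q q_le m by (intro mult_left_mono powr_mono2') auto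
    also have "\<dots> = real q * (c / real q powr m)" using q by (simp add: powr_diff)
    also have "\<dots> \<le> \<bar>y\<bar>" unfolding y_eq using lower[of n q] n q ne by (intro mult_left_mono) auto
    also have "\<dots> \<le> 3 * \<bar>sin (real n)\<bar>" using abs_sin_ge_third[OF y2] sin_eq by simp
    finally show ?thesis by simp
  qed
  then show thesis using that[of "c / 3"] c by simp
qed

lemma tendsto_flint_hills_terms:
  fixes u v :: real
  assumes "u > 0" "v > 0" and fin: "finite (good_approximations pi m)" and m: "m < 1 + u / v"
  shows "(\<lambda>n. 1 / (real n powr u * \<bar>sin (real n)\<bar> powr v)) \<longlonglongrightarrow> 0"
proof -
  \<comment> \<open>Raising the exponent to at least 1 preserves finiteness, makes the lower bound
    for the sine available, and stays below \<open>1 + u / v\<close> because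
    \<open>u / v > 0\<close>.\<close>
  define m' where "m' = max m 1"
  define e where "e = u - (m' - 1) * v"
  have m': "1 \<le> m'" "m' < 1 + u / v" using m assms by (auto simp: m'_def)
  have e: "0 < e" using m' \<open>v > 0\<close> by (simp add: e_def field_simps)
  have "finite (good_approximations pi m')"
    using fin good_approximations_antimono[of m m' pi] by (auto simp: m'_def intro: finite_subset)
  then obtain c where c: "0 < c"
    and lower: "\<And>n. 2 \<le> n \<Longrightarrow> sin (real n) \<noteq> 0 \<Longrightarrow> c * real n powr (1 - m') \<le> \<bar>sin (real n)\<bar>"
    using m' by (auto elim: abs_sin_nat_lower_bound)
  have upper: "1 / (real n powr u * \<bar>sin (real n)\<bar> powr v) \<le> real n powr - e / c powr v" if n: "2 \<le> n" for n
  proof (cases "sin (real n) = 0")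
    case False
    have "1 / (real n powr u * \<bar>sin (real n)\<bar> powr v) \<le> 1 / (real n powr u * (c * real n powr (1 - m')) powr v)"
      using lower[OF n False] False c n \<open>v > 0\<close> by (intro divide_left_mono mult_left_mono powr_mono2 mult_pos_pos) auto
    also have "\<dots> = 1 / (c powr v * real n powr e)"
      using c n by (simp add: powr_mult powr_powr powr_add[symmetric] e_def algebra_simps)
    also have "\<dots> = real n powr - e / c powr v"
      by (simp add: powr_minus field_simps)
    finally show ?thesis .
  qed auto
  have "(\<lambda>n. real n powr - e) \<longlonglongrightarrow> 0"
    using e by (intro tendsto_neg_powr filterlim_real_sequentially) auto
  then have lim: "(\<lambda>n. real n powr - e / c powr v) \<longlonglongrightarrow> 0"
    by (rule tendsto_divide_zero)
  show ?thesis
    by (rule tendsto_sandwich[OF _ _ tendsto_const lim])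
      (auto intro!: eventually_sequentiallyI[of 2] upper)
qed

theorem corollary3:
  fixes u v :: real
  assumes "u > 0" and "v > 0"
  shows "(convergent (\<lambda>n. 1 / (real (Suc n) powr u * \<bar>sin (real (Suc n))\<bar> powr v)) \<longrightarrow>
            irrationality_measure pi \<le> ereal (1 + u / v)) \<and>
         (\<not> convergent (\<lambda>n. 1 / (real (Suc n) powr u * \<bar>sin (real (Suc n))\<bar> powr v)) \<longrightarrow>
            irrationality_measure pi \<ge> ereal (1 + u / v))"
proof (intro conjI impI)
  assume "convergent (\<lambda>n. 1 / (real (Suc n) powr u * \<bar>sin (real (Suc n))\<bar> powr v))"
  then have "Bseq (\<lambda>n. 1 / (real (Suc n) powr u * \<bar>sin (real (Suc n))\<bar> powr v))"
    by (rule convergent_imp_Bseq)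
  then obtain C where C: "\<And>n. norm (1 / (real (Suc n) powr u * \<bar>sin (real (Suc n))\<bar> powr v)) \<le> C"
    unfolding Bseq_def by blast
  have bound: "1 / (real n powr u * \<bar>sin (real n)\<bar> powr v) \<le> C" if "0 < n" for n
    using C[of "n - 1"] that by (simp add: abs_mult)
  show "irrationality_measure pi \<le> ereal (1 + u / v)"
  \<comment> \<open>Finiteness is known only strictly above \<open>1 + u / v\<close>, so the infimum
    is bounded up to an arbitrary \<open>e > 0\<close>.\<close>
  proof (rule ereal_le_epsilon2)
    fix e :: real
    assume "0 < e"
    then have "finite (good_approximations pi (1 + u / v + e))"
      using assms bound by (intro finite_good_approximations_pi[of u v C]) auto
    then have "irrationality_measure pi \<le> ereal (1 + u / v + e)"
      unfolding irrationality_measure_def by (intro Inf_lower) auto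
    then show "irrationality_measure pi \<le> ereal (1 + u / v) + ereal e" by simp
  qed
next
  assume div: "\<not> convergent (\<lambda>n. 1 / (real (Suc n) powr u * \<bar>sin (real (Suc n))\<bar> powr v))"
  show "ereal (1 + u / v) \<le> irrationality_measure pi"
    unfolding irrationality_measure_def
  proof (rule Inf_greatest, clarify)
    fix m
    assume "finite (good_approximations pi m)"
    \<comment> \<open>A smaller \<open>m\<close> would make the sequence tend to 0, and so would its
      shift by \<open>Suc\<close>, against divergence.\<close>
    then have "\<not> m < 1 + u / v"
      using div LIMSEQ_Suc[OF tendsto_flint_hills_terms[OF assms]] by (auto simp: convergent_def)
    then show "ereal (1 + u / v) \<le> ereal m" by simp
  qed
qed

end
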